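(* Let $(L,\cdot)$ be a quasigroup (respectively, a loop) with holomorph $H(L)$. Then $H(L)$ is a CIPQ (respectively, a CIPL) if and only if all of the following hold: 1. $AUM(L)$ is an abelian group; 2. $(\beta^{-1},\alpha,I)\in AUT(L)$ for all $\alpha,\beta\in AUM(L)$; and 3. $L$ is a CIPQ (respectively, a CIPL).
   Context: Mappings are written on the right of their arguments and composed from left to right. A quasigroup $(L,\cdot)$ is a non-empty set with a binary operation such that for all $a,b\in L$ the equations $a\cdot x=b$ and $y\cdot a=b$ have unique solutions $x,y\in L$; a loop is a quasigroup with a two-sided identity element $e$. For $x\in L$, the right inverse $x^\rho=xJ_\rho$ and left inverse $x^\lambda=xJ_\lambda$ are the elements with $x x^\rho=e^\rho$ and $x^\lambda x=e^\lambda$, where $e^\rho$ and $e^\lambda$ denote a right identity element and a left identity element of $L$ (assumed to exist whenever $x^\rho$, respectively $x^\lambda$, is used; both equal $e$ in a loop). $AUM(L)$ is the automorphism group of $(L,\cdot)$. $AUT(L)$ is the group of autotopisms of $(L,\cdot)$, i.e. triples $(A,B,C)$ of bijections of $L$ with $xA\cdot yB=(x\cdot y)C$ for all $x,y\in L$. $I$ is the identity map. The holomorph $H(L)=(H,\circ)$ is the set $H$ of pairs $(\alpha,x)$, $\alpha\in AUM(L)$, $x\in L$, with operation $(\alpha,x)\circ(\beta,y)=(\alpha\beta,\,x\beta\cdot y)$. A quasigroup (loop) is a cross inverse property quasigroup, CIPQ (cross inverse property loop, CIPL), if and only if it obeys one of the (equivalent) identities $xy\cdot x^\rho=y$, or $x\cdot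 yx^\rho=y$, or $x^\lambda\cdot(yx)=y$, or $x^\lambda y\cdot x=y$. Here juxtaposition binds more tightly than $\cdot$. *)

theory Defs
  imports "HOL-Algebra.Bij"
begin

text \<open>
  Quasigroups and loops live in the record type of \<^term>\<open>hom\<close> and \<^term>\<open>AutoGroup\<close>; only
  carrier and multiplication are used. The \<open>one\<close> field carries no information: identity
  elements, one- or two-sided, are always characterised by their equations.
\<close>

locale quasigroup =
  fixes L (structure)
  assumes nonempty: "carrier L \<noteq> {}"
    and closed: "\<lbrakk>a \<in> carrier L; b \<in> carrier L\<rbrakk> \<Longrightarrow> a \<otimes> b \<in> carrier L"
    and right_division:
      "\<lbrakk>a \<in> carrier L; b \<in> carrier L\<rbrakk> \<Longrightarrow> \<exists>!x. x \<in> carrier L \<and> a \<otimes> x = b"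
    and left_division:
      "\<lbrakk>a \<in> carrier L; b \<in> carrier L\<rbrakk> \<Longrightarrow> \<exists>!y. y \<in> carrier L \<and> y \<otimes> a = b"

definition right_identity :: "('a, 'b) monoid_scheme \<Rightarrow> 'a \<Rightarrow> bool" where
  "right_identity L e \<longleftrightarrow> e \<in> carrier L \<and> (\<forall>x\<in>carrier L. x \<otimes>\<^bsub>L\<^esub> e = x)"

definition left_identity :: "('a, 'b) monoid_scheme \<Rightarrow> 'a \<Rightarrow> bool" where
  "left_identity L e \<longleftrightarrow> e \<in> carrier L \<and> (\<forall>x\<in>carrier L. e \<otimes>\<^bsub>L\<^esub> x = x)"

locale loop = quasigroup +
  assumes two_sided_identity: "\<exists>e. left_identity L e \<and> right_identity L e"

text \<open>
  In a quasigroup a right (left) identity is unique if it exists, and then every element has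
  exactly one right (left) inverse. Without such an identity the following descriptions are
  meaningless, so each use below is guarded by its existence.
\<close>

definition right_inverse :: "('a, 'b) monoid_scheme \<Rightarrow> 'a \<Rightarrow> 'a" where
  "right_inverse L x =
    (THE z. z \<in> carrier L \<and> x \<otimes>\<^bsub>L\<^esub> z = (THE e. right_identity L e))"

definition left_inverse :: "('a, 'b) monoid_scheme \<Rightarrow> 'a \<Rightarrow> 'a" where
  "left_inverse L x =
    (THE z. z \<in> carrier L \<and> z \<otimes>\<^bsub>L\<^esub> x = (THE e. left_identity L e))"

definition cross_inverse_property :: "('a, 'b) monoid_scheme \<Rightarrow> bool" where
  "cross_inverse_property L \<longleftrightarrow>
    (\<exists>e. right_identity L e) \<and>
      (\<forall>x\<in>carrier L. \<forall>y\<in>carrier L. (x \<otimes>\<^bsub>L\<^esub> y) \<otimes>\<^bsub>L\<^esub> right_inverse L x = y) \<or>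
    (\<exists>e. right_identity L e) \<and>
      (\<forall>x\<in>carrier L. \<forall>y\<in>carrier L. x \<otimes>\<^bsub>L\<^esub> (y \<otimes>\<^bsub>L\<^esub> right_inverse L x) = y) \<or>
    (\<exists>e. left_identity L e) \<and>
      (\<forall>x\<in>carrier L. \<forall>y\<in>carrier L. left_inverse L x \<otimes>\<^bsub>L\<^esub> (y \<otimes>\<^bsub>L\<^esub> x) = y) \<or>
    (\<exists>e. left_identity L e) \<and>
      (\<forall>x\<in>carrier L. \<forall>y\<in>carrier L. (left_inverse L x \<otimes>\<^bsub>L\<^esub> y) \<otimes>\<^bsub>L\<^esub> x = y)"

definition CIPQ :: "('a, 'b) monoid_scheme \<Rightarrow> bool" where
  "CIPQ L \<longleftrightarrow> quasigroup L \<and> cross_inverse_property L"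

definition CIPL :: "('a, 'b) monoid_scheme \<Rightarrow> bool" where
  "CIPL L \<longleftrightarrow> loop L \<and> cross_inverse_property L"

definition autotopisms :: "('a, 'b) monoid_scheme \<Rightarrow> (('a \<Rightarrow> 'a) \<times> ('a \<Rightarrow> 'a) \<times> ('a \<Rightarrow> 'a)) set" where
  "autotopisms L =
    {(A, B, C). A \<in> Bij (carrier L) \<and> B \<in> Bij (carrier L) \<and> C \<in> Bij (carrier L) \<and>
      (\<forall>x\<in>carrier L. \<forall>y\<in>carrier L. A x \<otimes>\<^bsub>L\<^esub> B y = C (x \<otimes>\<^bsub>L\<^esub> y))}"

text \<open>
  Maps act on the right in the source, so the product of \<open>\<alpha>\<close> and \<open>\<beta>\<close> there (first \<open>\<alpha>\<close>, then
  \<open>\<beta>\<close>) is \<^term>\<open>compose (carrier L) \<beta> \<alpha>\<close>. The multiplication of \<^term>\<open>AutoGroup L\<close> is the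
  opposite one, which affects neither commutativity nor inverses.
\<close>

definition holomorph :: "('a, 'b) monoid_scheme \<Rightarrow> (('a \<Rightarrow> 'a) \<times> 'a) monoid" where
  "holomorph L =
    \<lparr>carrier = auto L \<times> carrier L,
     mult = (\<lambda>(\<alpha>, x) (\<beta>, y). (compose (carrier L) \<beta> \<alpha>, \<beta> x \<otimes>\<^bsub>L\<^esub> y)),
     one = (\<one>\<^bsub>AutoGroup L\<^esub>, \<one>\<^bsub>L\<^esub>)\<rparr>"

end

theory Submission
  imports Defs
begin

text \<open>
  Each of the four cross inverse identities turns the one-sided identity element \<open>e\<close> that it
  presupposes into a two-sided one: substitute \<open>e\<close> for \<open>x\<close> and use that \<open>e\<close> is its own inverse.
  So a CIPQ is the same thing as a CIPL, and all four identities say that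
  \<open>x \<otimes> z = e\<close> implies \<open>(x \<otimes> y) \<otimes> z = y\<close>; this is \<open>cross_inverse_property_iff\<close>. The quasigroup
  and the loop versions of the theorem therefore coincide.

  Both sides of the equivalence force every automorphism \<open>\<alpha>\<close> of \<open>L\<close> to be the identity map \<open>I\<close>.
  In a cross inverse holomorph, \<open>(\<alpha>, e)\<close> has the inverse \<open>(\<gamma>, e)\<close> with \<open>\<gamma> = \<alpha>\<^sup>-\<^sup>1\<close>, and the cross
  inverse law applied to \<open>(\<alpha>, e)\<close> and \<open>(I, y)\<close> reads \<open>\<gamma> y = y\<close>
  (\<open>auto_trivial_if_holomorph_CIPQ\<close>). On the other side, the autotopism \<open>(I, \<alpha>, I)\<close> says
  \<open>e \<otimes> \<alpha> y = e \<otimes> y\<close> (\<open>auto_trivial_if_autotopisms\<close>).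
  Once \<open>I\<close> is the only automorphism, conditions 1 and 2 hold for trivial reasons and
  \<open>x \<mapsto> (I, x)\<close> is an isomorphism from \<open>L\<close> onto its holomorph. As the cross inverse property
  is invariant under isomorphism (\<open>CIPQ_iso\<close>), only condition 3 remains to be compared.
\<close>

section \<open>The cross inverse property as a property of loops\<close>

context quasigroup
begin

lemma left_cancel:
  assumes "a \<in> carrier L" "x \<in> carrier L" "y \<in> carrier L" "a \<otimes> x = a \<otimes> y"
  shows "x = y"
  using right_division[OF assms(1) closed[OF assms(1,2)]] assms by auto

lemma right_cancel:
  assumes "a \<in> carrier L" "x \<in> carrier L" "y \<in> carrier L" "x \<otimes> a = y \<otimes> a"
  shows "x = y"
  using left_division[OF assms(1) closed[OF assms(2,1)]] assms by auto

lemma right_inverse_eqI: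
  assumes e: "right_identity L e" and "x \<in> carrier L" "z \<in> carrier L" "x \<otimes> z = e"
  shows "right_inverse L x = z"
proof -
  have "e' = e" if "right_identity L e'" for e'
    using that e left_cancel[of e e' e] unfolding right_identity_def by auto
  then have "(THE e. right_identity L e) = e"
    using e by (rule the_equality[rotated])
  then show ?thesis
    unfolding right_inverse_def using assms by (auto intro!: the_equality intro: left_cancel)
qed

lemma left_inverse_eqI:
  assumes e: "left_identity L e" and "x \<in> carrier L" "z \<in> carrier L" "z \<otimes> x = e"
  shows "left_inverse L x = z"
proof -
  have "e' = e" if "left_identity L e'" for e'
    using that e right_cancel[of e e' e] unfolding left_identity_def by auto
  then have "(THE e. left_identity L e) = e"
    using e by (rule the_equality[rotated])
  then show ?thesis
    unfolding left_inverse_def using assms by (auto intro!: the_equality intro: right_cancel)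
qed

text \<open>
  Writing the law with an explicit witness \<open>z\<close> instead of an inverse operation treats \<open>z\<close> as
  the right inverse of \<open>x\<close> and \<open>x\<close> as the left inverse of \<open>z\<close> at once, which is why the left
  and the right identities lead to the same condition. The inner and the outer form of each
  identity differ by one cancellation of \<open>x\<close>.
\<close>

lemma cross_inverse_property_iff:
  "cross_inverse_property L \<longleftrightarrow>
    (\<exists>e. left_identity L e \<and> right_identity L e \<and>
      (\<forall>x\<in>carrier L. \<forall>y\<in>carrier L. \<forall>z\<in>carrier L. x \<otimes> z = e \<longrightarrow> (x \<otimes> y) \<otimes> z = y))"
    (is "_ \<longleftrightarrow> ?cross")
proof
  assume "cross_inverse_property L"
  then consider
      (right_outer) e where "right_identity L e"
        "\<And>x y. \<lbrakk>x \<in> carrier L; y \<in> carrier L\<rbrakk> \<Longrightarrow> (x \<otimes> y) \<otimes> right_inverse L x = y"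
    | (right_inner) e where "right_identity L e"
        "\<And>x y. \<lbrakk>x \<in> carrier L; y \<in> carrier L\<rbrakk> \<Longrightarrow> x \<otimes> (y \<otimes> right_inverse L x) = y"
    | (left_inner) e where "left_identity L e"
        "\<And>x y. \<lbrakk>x \<in> carrier L; y \<in> carrier L\<rbrakk> \<Longrightarrow> left_inverse L x \<otimes> (y \<otimes> x) = y"
    | (left_outer) e where "left_identity L e"
        "\<And>x y. \<lbrakk>x \<in> carrier L; y \<in> carrier L\<rbrakk> \<Longrightarrow> (left_inverse L x \<otimes> y) \<otimes> x = y"
    unfolding cross_inverse_property_def by metis
  then show ?cross
  proof cases
    case right_outer
    then have e: "e \<in> carrier L" "\<And>x. x \<in> carrier L \<Longrightarrow> x \<otimes> e = x"
      by (auto simp: right_identity_def)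
    then have "right_inverse L e = e"
      using right_outer(1) right_inverse_eqI by blast
    then have "left_identity L e"
      using e right_outer(2)[of e] closed[of e] by (auto simp: left_identity_def)
    moreover have "(x \<otimes> y) \<otimes> z = y"
      if "x \<in> carrier L" "y \<in> carrier L" "z \<in> carrier L" "x \<otimes> z = e" for x y z
      using that right_outer right_inverse_eqI by metis
    ultimately show ?thesis using right_outer(1) by blast
  next
    case right_inner
    then have e: "e \<in> carrier L" "\<And>x. x \<in> carrier L \<Longrightarrow> x \<otimes> e = x"
      by (auto simp: right_identity_def)
    then have "right_inverse L e = e"
      using right_inner(1) right_inverse_eqI by blast
    then have "left_identity L e"
      using e right_inner(2)[of e] by (auto simp: left_identity_def)
    moreover have "(x \<otimes> y) \<otimes> z = y"
      if "x \<in> carrier L" "y \<in> carrier L" "z \<in> carrier L" "x \<otimes> z = e" for x y z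
    proof (rule left_cancel)
      show "x \<otimes> ((x \<otimes> y) \<otimes> z) = x \<otimes> y"
        using that right_inner right_inverse_eqI closed by metis
    qed (use that closed in auto)
    ultimately show ?thesis using right_inner(1) by blast
  next
    case left_inner
    then have e: "e \<in> carrier L" "\<And>x. x \<in> carrier L \<Longrightarrow> e \<otimes> x = x"
      by (auto simp: left_identity_def)
    then have "left_inverse L e = e"
      using left_inner(1) left_inverse_eqI by blast
    then have "right_identity L e"
      using e left_inner(2)[of e] closed[of _ e] by (auto simp: right_identity_def)
    moreover have "(x \<otimes> y) \<otimes> z = y"
      if "x \<in> carrier L" "y \<in> carrier L" "z \<in> carrier L" "x \<otimes> z = e" for x y z
    proof (rule left_cancel)
      show "x \<otimes> ((x \<otimes> y) \<otimes> z) = x \<otimes> y"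
        using that left_inner left_inverse_eqI closed by metis
    qed (use that closed in auto)
    ultimately show ?thesis using left_inner(1) by blast
  next
    case left_outer
    then have e: "e \<in> carrier L" "\<And>x. x \<in> carrier L \<Longrightarrow> e \<otimes> x = x"
      by (auto simp: left_identity_def)
    then have "left_inverse L e = e"
      using left_outer(1) left_inverse_eqI by blast
    then have "right_identity L e"
      using e left_outer(2)[of e] by (auto simp: right_identity_def)
    moreover have "(x \<otimes> y) \<otimes> z = y"
      if "x \<in> carrier L" "y \<in> carrier L" "z \<in> carrier L" "x \<otimes> z = e" for x y z
      using that left_outer left_inverse_eqI by metis
    ultimately show ?thesis using left_outer(1) by blast
  qed
next
  assume ?cross
  then obtain e where e: "right_identity L e"
    and cross: "\<And>x y z. \<lbrakk>x \<in> carrier L; y \<in> carrier L; z \<in> carrier L; x \<otimes> z = e\<rbrakk>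
      \<Longrightarrow> (x \<otimes> y) \<otimes> z = y"
    by blast
  have "(x \<otimes> y) \<otimes> right_inverse L x = y" if "x \<in> carrier L" "y \<in> carrier L" for x y
  proof -
    obtain z where "z \<in> carrier L" "x \<otimes> z = e"
      using right_division[of x e] \<open>x \<in> carrier L\<close> e unfolding right_identity_def by blast
    then show ?thesis using cross right_inverse_eqI[OF e] that by metis
  qed
  then show "cross_inverse_property L"
    unfolding cross_inverse_property_def using e by blast
qed

end

lemma CIPQ_iff:
  "CIPQ L \<longleftrightarrow> quasigroup L \<and>
    (\<exists>e. left_identity L e \<and> right_identity L e \<and>
      (\<forall>x\<in>carrier L. \<forall>y\<in>carrier L. \<forall>z\<in>carrier L.
        x \<otimes>\<^bsub>L\<^esub> z = e \<longrightarrow> (x \<otimes>\<^bsub>L\<^esub> y) \<otimes>\<^bsub>L\<^esub> z = y))"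
  unfolding CIPQ_def using quasigroup.cross_inverse_property_iff by blast

lemma CIPL_iff_CIPQ: "CIPL L \<longleftrightarrow> CIPQ L"
  unfolding CIPL_def CIPQ_def loop_def loop_axioms_def
  using quasigroup.cross_inverse_property_iff by blast

section \<open>Invariance under isomorphism\<close>

lemma quasigroup_iso:
  assumes L: "quasigroup L" and h: "h \<in> iso L M"
  shows "quasigroup M"
proof -
  interpret quasigroup L by (fact L)
  have bij: "bij_betw h (carrier L) (carrier M)"
    and mult: "\<And>x y. \<lbrakk>x \<in> carrier L; y \<in> carrier L\<rbrakk> \<Longrightarrow> h (x \<otimes>\<^bsub>L\<^esub> y) = h x \<otimes>\<^bsub>M\<^esub> h y"
    using h by (auto simp: iso_def hom_def)
  from bij have im: "carrier M = h ` carrier L" and inj: "inj_on h (carrier L)"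
    by (auto simp: bij_betw_def)
  show ?thesis
  proof
    show "carrier M \<noteq> {}" using nonempty im by simp
  next
    fix a b assume "a \<in> carrier M" "b \<in> carrier M"
    then obtain a' b' where ab: "a' \<in> carrier L" "b' \<in> carrier L" "a = h a'" "b = h b'"
      using im by auto
    then show "a \<otimes>\<^bsub>M\<^esub> b \<in> carrier M"
      using closed im by (simp flip: mult)
    obtain x where x: "x \<in> carrier L" "a' \<otimes>\<^bsub>L\<^esub> x = b'"
      using right_division ab by blast
    show "\<exists>!x. x \<in> carrier M \<and> a \<otimes>\<^bsub>M\<^esub> x = b"
    proof (rule ex1I[of _ "h x"])
      show "h x \<in> carrier M \<and> a \<otimes>\<^bsub>M\<^esub> h x = b"
        using x ab im by (simp flip: mult)
    next
      fix u assume "u \<in> carrier M \<and> a \<otimes>\<^bsub>M\<^esub> u = b"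
      then obtain v where v: "v \<in> carrier L" "u = h v" "h (a' \<otimes>\<^bsub>L\<^esub> v) = h b'"
        using im ab by (auto simp: mult)
      then have "a' \<otimes>\<^bsub>L\<^esub> v = b'" using inj ab closed by (auto dest: inj_onD)
      then show "u = h x" using x v ab left_cancel by blast
    qed
    obtain y where y: "y \<in> carrier L" "y \<otimes>\<^bsub>L\<^esub> a' = b'"
      using left_division ab by blast
    show "\<exists>!y. y \<in> carrier M \<and> y \<otimes>\<^bsub>M\<^esub> a = b"
    proof (rule ex1I[of _ "h y"])
      show "h y \<in> carrier M \<and> h y \<otimes>\<^bsub>M\<^esub> a = b"
        using y ab im by (simp flip: mult)
    next
      fix u assume "u \<in> carrier M \<and> u \<otimes>\<^bsub>M\<^esub> a = b"
      then obtain v where v: "v \<in> carrier L" "u = h v" "h (v \<otimes>\<^bsub>L\<^esub> a') = h b'"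
        using im ab by (auto simp: mult)
      then have "v \<otimes>\<^bsub>L\<^esub> a' = b'" using inj ab closed by (auto dest: inj_onD)
      then show "u = h y" using y v ab right_cancel by blast
    qed
  qed
qed

text \<open>
  By \<open>CIPQ_iff\<close>, the cross inverse property is a condition on equations between products
  alone, and \<open>h\<close> carries such equations back and forth.
\<close>

lemma CIPQ_iso:
  assumes L: "CIPQ L" and h: "h \<in> iso L M"
  shows "CIPQ M"
proof -
  interpret quasigroup L using L by (simp add: CIPQ_def)
  have bij: "bij_betw h (carrier L) (carrier M)"
    and mult: "\<And>x y. \<lbrakk>x \<in> carrier L; y \<in> carrier L\<rbrakk> \<Longrightarrow> h (x \<otimes>\<^bsub>L\<^esub> y) = h x \<otimes>\<^bsub>M\<^esub> h y"
    using h by (auto simp: iso_def hom_def)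
  from bij have im: "carrier M = h ` carrier L" and inj: "inj_on h (carrier L)"
    by (auto simp: bij_betw_def)
  obtain e where e: "left_identity L e" "right_identity L e"
    and cross: "\<And>x y z. \<lbrakk>x \<in> carrier L; y \<in> carrier L; z \<in> carrier L; x \<otimes>\<^bsub>L\<^esub> z = e\<rbrakk>
      \<Longrightarrow> (x \<otimes>\<^bsub>L\<^esub> y) \<otimes>\<^bsub>L\<^esub> z = y"
    using L unfolding CIPQ_iff by blast
  have "left_identity M (h e)" "right_identity M (h e)"
    using e im by (auto simp: left_identity_def right_identity_def simp flip: mult)
  moreover have "(x \<otimes>\<^bsub>M\<^esub> y) \<otimes>\<^bsub>M\<^esub> z = y"
    if "x \<in> carrier M" "y \<in> carrier M" "z \<in> carrier M" "x \<otimes>\<^bsub>M\<^esub> z = h e" for x y z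
  proof -
    obtain u v w where uvw: "u \<in> carrier L" "v \<in> carrier L" "w \<in> carrier L"
        "x = h u" "y = h v" "z = h w"
      using \<open>x \<in> carrier M\<close> \<open>y \<in> carrier M\<close> \<open>z \<in> carrier M\<close> im by auto
    then have "h (u \<otimes>\<^bsub>L\<^esub> w) = h e" using \<open>x \<otimes>\<^bsub>M\<^esub> z = h e\<close> by (simp add: mult)
    then have "u \<otimes>\<^bsub>L\<^esub> w = e"
      using inj uvw closed e by (auto simp: left_identity_def dest: inj_onD)
    then show ?thesis using cross[of u v w] uvw closed by (simp flip: mult)
  qed
  ultimately show ?thesis
    unfolding CIPQ_iff using quasigroup_iso[OF quasigroup_axioms h] by blast
qed

section \<open>Automorphisms and the holomorph\<close>

lemma id_in_auto: "(\<lambda>x\<in>carrier L. x) \<in> auto L" if "quasigroup L"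
  using quasigroup.closed[OF that]
  by (auto simp: auto_def hom_def Bij_def bij_betw_def inj_on_def)

lemma (in quasigroup) auto_fixes_identity:
  assumes "\<gamma> \<in> auto L" "left_identity L e" "right_identity L e"
  shows "\<gamma> e = e"
proof -
  have "e \<in> carrier L" "\<gamma> e \<in> carrier L"
    using assms by (auto simp: auto_def hom_def left_identity_def)
  moreover from this have "\<gamma> e \<otimes> \<gamma> e = \<gamma> e \<otimes> e"
    using assms by (simp add: auto_def hom_def left_identity_def right_identity_def) metis
  ultimately show ?thesis using left_cancel by blast
qed

lemma auto_eq_idI:
  assumes "\<alpha> \<in> auto L" "\<And>y. y \<in> carrier L \<Longrightarrow> \<alpha> y = y"
  shows "\<alpha> = (\<lambda>x\<in>carrier L. x)"
  using assms by (intro extensionalityI[of _ "carrier L"]) (auto simp: auto_def Bij_def)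

lemma carrier_holomorph: "carrier (holomorph L) = auto L \<times> carrier L"
  by (simp add: holomorph_def)

lemma mult_holomorph:
  "(\<alpha>, x) \<otimes>\<^bsub>holomorph L\<^esub> (\<beta>, y) = (compose (carrier L) \<beta> \<alpha>, \<beta> x \<otimes>\<^bsub>L\<^esub> y)"
  by (simp add: holomorph_def)

lemma iso_holomorph_if_auto_trivial:
  assumes L: "quasigroup L" and triv: "auto L = {\<lambda>x\<in>carrier L. x}"
  shows "(\<lambda>x. (\<lambda>x\<in>carrier L. x, x)) \<in> iso L (holomorph L)"
proof -
  interpret quasigroup L by (fact L)
  have "compose (carrier L) (\<lambda>x\<in>carrier L. x) (\<lambda>x\<in>carrier L. x) = (\<lambda>x\<in>carrier L. x)"
    by (auto simp: compose_def)
  then show ?thesis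
    by (auto simp: iso_def hom_def carrier_holomorph mult_holomorph triv closed
        bij_betw_def inj_on_def)
qed

lemma CIPQ_holomorph_iff_if_auto_trivial:
  assumes L: "quasigroup L" and triv: "auto L = {\<lambda>x\<in>carrier L. x}"
  shows "CIPQ (holomorph L) \<longleftrightarrow> CIPQ L"
proof -
  let ?h = "\<lambda>x. (\<lambda>x\<in>carrier L. x, x)"
  have h: "?h \<in> iso L (holomorph L)"
    by (rule iso_holomorph_if_auto_trivial[OF L triv])
  interpret quasigroup L by (fact L)
  have "snd \<in> iso (holomorph L) L"
    by (auto simp: iso_def hom_def carrier_holomorph mult_holomorph triv closed
        bij_betw_def inj_on_def)
  then show ?thesis using CIPQ_iso[of "holomorph L" snd L] CIPQ_iso[OF _ h] by blast
qed

section \<open>Both sides force a trivial automorphism group\<close>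

text \<open>
  Multiplying with the identity element \<open>(\<epsilon>, e)\<close> of the holomorph on either side of \<open>(I, y)\<close>
  shows that \<open>\<epsilon> = I\<close> and that \<open>e\<close> is a two-sided identity of \<open>L\<close>. For an automorphism \<open>\<alpha>\<close>,
  division in the holomorph gives a right inverse \<open>(\<gamma>, z)\<close> of \<open>(\<alpha>, e)\<close>, and \<open>z = e\<close> because \<open>\<gamma>\<close>
  fixes \<open>e\<close>. The product \<open>((\<alpha>, e) \<circ> (I, y)) \<circ> (\<gamma>, e)\<close> has second component \<open>\<gamma> y\<close>, while the
  cross inverse law says that it equals \<open>(I, y)\<close>. Hence \<open>\<gamma> = I\<close>, and with it \<open>\<alpha> = I\<close>.
\<close>

lemma auto_trivial_if_holomorph_CIPQ:
  assumes L: "quasigroup L" and H: "CIPQ (holomorph L)"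
  shows "auto L = {\<lambda>x\<in>carrier L. x}"
proof -
  interpret quasigroup L by (fact L)
  interpret H: quasigroup "holomorph L" using H by (simp add: CIPQ_def)
  let ?I = "\<lambda>x\<in>carrier L. x"
  have I: "?I \<in> auto L" by (rule id_in_auto) (fact L)
  obtain \<epsilon> e where id: "left_identity (holomorph L) (\<epsilon>, e)" "right_identity (holomorph L) (\<epsilon>, e)"
    and cross: "\<And>p q r. \<lbrakk>p \<in> carrier (holomorph L); q \<in> carrier (holomorph L);
        r \<in> carrier (holomorph L); p \<otimes>\<^bsub>holomorph L\<^esub> r = (\<epsilon>, e)\<rbrakk>
      \<Longrightarrow> (p \<otimes>\<^bsub>holomorph L\<^esub> q) \<otimes>\<^bsub>holomorph L\<^esub> r = q"
    using H unfolding CIPQ_iff by force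
  have \<epsilon>: "\<epsilon> \<in> auto L" and e: "e \<in> carrier L"
    using id by (auto simp: left_identity_def carrier_holomorph)
  have left: "(\<epsilon>, e) \<otimes>\<^bsub>holomorph L\<^esub> (?I, y) = (?I, y)"
    and right: "(?I, y) \<otimes>\<^bsub>holomorph L\<^esub> (\<epsilon>, e) = (?I, y)" if "y \<in> carrier L" for y
    using id that I by (auto simp: left_identity_def right_identity_def carrier_holomorph
        simp del: restrict_apply)
  have left_e: "e \<otimes>\<^bsub>L\<^esub> y = y" if "y \<in> carrier L" for y
    using left[OF that] e by (simp add: mult_holomorph)
  have "\<epsilon> y = y" if "y \<in> carrier L" for y
    using right[OF e] that by (simp add: mult_holomorph) (metis compose_eq restrict_apply')
  then have \<epsilon>_eq: "\<epsilon> = ?I"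
    using auto_eq_idI[OF \<epsilon>] by blast
  have right_e: "y \<otimes>\<^bsub>L\<^esub> e = y" if "y \<in> carrier L" for y
    using right[OF that] that by (simp add: mult_holomorph \<epsilon>_eq)
  have "\<alpha> = ?I" if \<alpha>: "\<alpha> \<in> auto L" for \<alpha>
  proof -
    obtain r where r: "r \<in> carrier (holomorph L)" "(\<alpha>, e) \<otimes>\<^bsub>holomorph L\<^esub> r = (\<epsilon>, e)"
      using H.right_division[of "(\<alpha>, e)" "(\<epsilon>, e)"] \<alpha> \<epsilon> e by (auto simp: carrier_holomorph)
    obtain \<gamma> z where rz: "r = (\<gamma>, z)" by (cases r)
    with r have \<gamma>: "\<gamma> \<in> auto L" and z: "z \<in> carrier L"
      and comp: "compose (carrier L) \<gamma> \<alpha> = ?I" and "\<gamma> e \<otimes>\<^bsub>L\<^esub> z = e"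
      by (auto simp: carrier_holomorph mult_holomorph \<epsilon>_eq)
    have "\<gamma> e = e"
      by (rule auto_fixes_identity[OF \<gamma>])
        (simp_all add: left_identity_def right_identity_def e left_e right_e)
    with \<open>\<gamma> e \<otimes>\<^bsub>L\<^esub> z = e\<close> z have ze: "z = e" by (simp add: left_e)
    have mapsto: "\<alpha> y \<in> carrier L" "\<gamma> y \<in> carrier L" if "y \<in> carrier L" for y
      using \<alpha> \<gamma> that by (auto simp: auto_def hom_def)
    have \<gamma>_id: "\<gamma> y = y" if y: "y \<in> carrier L" for y
      using cross[of "(\<alpha>, e)" "(?I, y)" r] r y e I \<alpha> mapsto[OF y]
      by (simp add: carrier_holomorph mult_holomorph rz ze left_e right_e)
    show ?thesis
    proof (rule auto_eq_idI[OF \<alpha>])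
      fix y assume y: "y \<in> carrier L"
      have "\<alpha> y = \<gamma> (\<alpha> y)" using \<gamma>_id mapsto y by simp
      also have "\<dots> = y" using fun_cong[OF comp, of y] y by (simp add: compose_eq)
      finally show "\<alpha> y = y" .
    qed
  qed
  then show ?thesis using I by blast
qed

lemma auto_trivial_if_autotopisms:
  assumes L: "quasigroup L" and e: "left_identity L e"
    and top: "\<And>\<alpha>. \<alpha> \<in> auto L \<Longrightarrow> (\<lambda>x\<in>carrier L. x, \<alpha>, \<lambda>x\<in>carrier L. x) \<in> autotopisms L"
  shows "auto L = {\<lambda>x\<in>carrier L. x}"
proof -
  interpret quasigroup L by (fact L)
  have "\<alpha> = (\<lambda>x\<in>carrier L. x)" if \<alpha>: "\<alpha> \<in> auto L" for \<alpha>
  proof (rule auto_eq_idI[OF \<alpha>])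
    fix y assume y: "y \<in> carrier L"
    have "e \<otimes>\<^bsub>L\<^esub> \<alpha> y = e \<otimes>\<^bsub>L\<^esub> y"
      using top[OF \<alpha>] y e closed by (auto simp: autotopisms_def left_identity_def)
    moreover have "\<alpha> y \<in> carrier L"
      using \<alpha> y by (auto simp: auto_def hom_def)
    ultimately show "\<alpha> y = y"
      using y e by (simp add: left_identity_def)
  qed
  then show ?thesis using id_in_auto[OF L] by blast
qed

lemma one_AutoGroup: "\<one>\<^bsub>AutoGroup L\<^esub> = (\<lambda>x\<in>carrier L. x)"
  by (simp add: AutoGroup_def BijGroup_def)

lemma comm_group_AutoGroup_if_auto_trivial:
  assumes L: "quasigroup L" and triv: "auto L = {\<lambda>x\<in>carrier L. x}"
  shows "comm_group (AutoGroup L)"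
proof -
  let ?I = "\<lambda>x\<in>carrier L. x"
  have "compose (carrier L) ?I ?I = ?I"
    by (auto simp: compose_def)
  moreover have "?I \<in> Bij (carrier L)"
    using id_in_auto[OF L] by (simp add: auto_def)
  ultimately have "?I \<otimes>\<^bsub>AutoGroup L\<^esub> ?I = ?I"
    by (simp add: AutoGroup_def BijGroup_def restrict_def[of _ "Bij (carrier L)"])
  moreover have "carrier (AutoGroup L) = {?I}"
    by (simp add: AutoGroup_def triv)
  ultimately show ?thesis
    by (intro comm_groupI) (simp_all add: one_AutoGroup del: restrict_apply)
qed

section \<open>The characterisation\<close>

lemma CIPQ_holomorph_iff:
  assumes L: "quasigroup L"
  shows "CIPQ (holomorph L) \<longleftrightarrow>
    comm_group (AutoGroup L) \<and>
    (\<forall>\<alpha>\<in>auto L. \<forall>\<beta>\<in>auto L.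
      (inv\<^bsub>AutoGroup L\<^esub> \<beta>, \<alpha>, \<lambda>x\<in>carrier L. x) \<in> autotopisms L) \<and>
    CIPQ L"
    (is "_ \<longleftrightarrow> _ \<and> ?autotopic \<and> _")
proof -
  let ?I = "\<lambda>x\<in>carrier L. x"
  have inv_I: "inv\<^bsub>AutoGroup L\<^esub> ?I = ?I" if "comm_group (AutoGroup L)"
  proof -
    interpret comm_group "AutoGroup L" by (fact that)
    show ?thesis using inv_one by (simp add: one_AutoGroup)
  qed
  show ?thesis
  proof (intro iffI conjI)
    assume H: "CIPQ (holomorph L)"
    have triv: "auto L = {?I}" by (rule auto_trivial_if_holomorph_CIPQ[OF L H])
    show comm: "comm_group (AutoGroup L)"
      by (rule comm_group_AutoGroup_if_auto_trivial[OF L triv])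
    have "?I \<in> Bij (carrier L)"
      using id_in_auto[OF L] by (simp add: auto_def)
    then have "(?I, ?I, ?I) \<in> autotopisms L"
      using quasigroup.closed[OF L] by (simp add: autotopisms_def)
    then show ?autotopic by (simp add: triv inv_I[OF comm])
    show "CIPQ L" using CIPQ_holomorph_iff_if_auto_trivial[OF L triv] H by simp
  next
    assume R: "comm_group (AutoGroup L) \<and> ?autotopic \<and> CIPQ L"
    then obtain e where e: "left_identity L e" unfolding CIPQ_iff by blast
    have "(?I, \<alpha>, ?I) \<in> autotopisms L" if "\<alpha> \<in> auto L" for \<alpha>
      using R that id_in_auto[OF L] inv_I by metis
    then have "auto L = {?I}"
      by (rule auto_trivial_if_autotopisms[OF L e])
    then show "CIPQ (holomorph L)"
      using CIPQ_holomorph_iff_if_auto_trivial[OF L] R by simp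
  qed
qed

theorem corollary2p1:
  fixes L :: "('a, 'b) monoid_scheme"
  shows "(quasigroup L \<longrightarrow>
           (CIPQ (holomorph L) \<longleftrightarrow>
             comm_group (AutoGroup L) \<and>
             (\<forall>\<alpha>\<in>auto L. \<forall>\<beta>\<in>auto L.
               (inv\<^bsub>AutoGroup L\<^esub> \<beta>, \<alpha>, \<lambda>x\<in>carrier L. x) \<in> autotopisms L) \<and>
             CIPQ L)) \<and>
         (loop L \<longrightarrow>
           (CIPL (holomorph L) \<longleftrightarrow>
             comm_group (AutoGroup L) \<and>
             (\<forall>\<alpha>\<in>auto L. \<forall>\<beta>\<in>auto L.
               (inv\<^bsub>AutoGroup L\<^esub> \<beta>, \<alpha>, \<lambda>x\<in>carrier L. x) \<in> autotopisms L) \<and>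
             CIPL L))"
  using CIPQ_holomorph_iff CIPL_iff_CIPQ unfolding loop_def by metis

end
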